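(* There is an absolute constant $C>0$ such that the following holds. Let $R>0$, let $P_0$ be a probability distribution on $[0,R]$ with strictly positive density $p_0$, and run the regularized-belief algorithm with prior $P_0$ and step sizes $\lambda_t=1/\sqrt{t}$. For every time horizon $T\ge 1$, every sequence $r_1^*,\ldots,r_T^*\in[0,R]$ and every $\alpha\in[0,1]$, the outputs $r_t(\alpha)$ satisfy $$\mathrm{Reg}_T(\alpha):=\sum_{t=1}^Tl_\alpha(r_t(\alpha),r_t^* )-\sum_{t=1}^Tl_\alpha(q_\alpha(r^*_{1:T}),r_t^* )\le C\left(\psi_\alpha(q_\alpha(r^*_{1:T}))\sqrt{T}+\sum_{t=1}^T\frac{1}{\mu_{t,\alpha}\sqrt{t}}\right),$$ where $\psi_\alpha(r)=\mathbb{E}_{r^*\sim P_0}[l_\alpha(r,r^* )]$ and $$\mu_{t,\alpha}=\inf\{p_0(r):\min(r_t(\alpha),r_t^* )\le r\le\max(r_t(\alpha),r_t^* )\}$$ (the right-hand side being read as $+\infty$ if some $\mu_{t,\alpha}=0$). Furthermore, if $P_0$ is the uniform distribution on $[0,R]$, then for all such $T$, $r^*_{1:T}$ and $\alpha$, $$\mathrm{Reg}_T(\alpha)\le C R\sqrt{T}.$$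
   Context: Quantile loss: $l_\alpha(r,r^* )=(\mathbf{1}[r\ge r^*]-\alpha)(r-r^* )$. Quantile: for a probability distribution $P$ on $[0,R]$, $q_\alpha(P)=\min\{x\in[0,R]:P([0,x])\ge\alpha\}$. $\bar P(r^*_{1:n})$ denotes the empirical distribution of $r_1^*,\ldots,r_n^*$, and $q_\alpha(r^*_{1:T})$ means $q_\alpha(\bar P(r^*_{1:T}))$. Regularized-belief algorithm: given the prior $P_0$ and step sizes $(\lambda_t)$ with $\lambda_1=1$ and $\lambda_t\in(0,1)$ for $t\ge2$, in round $t$ it forms $P_t=\lambda_tP_0+(1-\lambda_t)\bar P(r^*_{1:t-1})$ (so $P_1=P_0$), outputs $r_t(\alpha)=q_\alpha(P_t)$ for each $\alpha\in[0,1]$, and then observes $r_t^*\in[0,R]$. *)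

theory Defs
  imports "HOL-Probability.Probability"
begin

definition qloss :: "real \<Rightarrow> real \<Rightarrow> real \<Rightarrow> real" where
  "qloss \<alpha> r s = (of_bool (r \<ge> s) - \<alpha>) * (r - s)"

text \<open>
  Distributions on \<open>[0, R]\<close> are measures on the Borel sets of the whole real line. The minimum is
  attained for every \<open>\<alpha> \<in> [0, 1]\<close> and every probability distribution on \<open>[0, R]\<close>.
\<close>

definition quantile :: "real \<Rightarrow> real \<Rightarrow> real measure \<Rightarrow> real" where
  "quantile R \<alpha> P = (LEAST x. x \<in> {0..R} \<and> measure P {0..x} \<ge> \<alpha>)"

text \<open>
  Sequences are indexed from 1. For \<open>n = 0\<close> this is the null measure, which only occurs
  with weight 0 (in the first round of the algorithm).
\<close>

definition empirical :: "(nat \<Rightarrow> real) \<Rightarrow> nat \<Rightarrow> real measure" where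
  "empirical s n = distr (uniform_count_measure {1..n}) borel s"

lemma measure_empirical:
  assumes "A \<in> sets borel"
  shows "measure (empirical s n) A = real (card {t \<in> {1..n}. s t \<in> A}) / real n"
proof -
  have "s -` A \<inter> {1..n} = {t \<in> {1..n}. s t \<in> A}" by auto
  moreover have "s \<in> measurable (uniform_count_measure {1..n}) borel"
    by (rule measurableI) (auto simp: space_uniform_count_measure sets_uniform_count_measure)
  ultimately have "measure (empirical s n) A =
      measure (uniform_count_measure {1..n}) {t \<in> {1..n}. s t \<in> A}"
    using assms unfolding empirical_def by (simp add: measure_distr space_uniform_count_measure)
  also have "\<dots> = real (card {t \<in> {1..n}. s t \<in> A}) / real (card {1..n})"
    by (rule measure_uniform_count_measure) auto
  finally show ?thesis by simp
qed

definition mixture :: "real \<Rightarrow> real measure \<Rightarrow> real measure \<Rightarrow> real measure" where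
  "mixture c P Q = measure_of UNIV (sets borel)
     (\<lambda>A. ennreal c * emeasure P A + ennreal (1 - c) * emeasure Q A)"

lemma sets_mixture [simp]: "sets (mixture c P Q) = sets borel"
  unfolding mixture_def by (metis sets.sets_measure_of_eq space_borel)

lemma emeasure_mixture:
  assumes [simp]: "sets P = sets borel" "sets Q = sets borel" and A: "A \<in> sets borel"
  shows "emeasure (mixture c P Q) A = ennreal c * emeasure P A + ennreal (1 - c) * emeasure Q A"
proof -
  have "countably_additive (sets borel)
      (\<lambda>A. ennreal c * emeasure P A + ennreal (1 - c) * emeasure Q A)"
    by (rule countably_additiveI)
       (simp add: suminf_add[symmetric] ennreal_suminf_cmult suminf_emeasure)
  moreover have "sigma_algebra UNIV (sets (borel :: real measure))"
    by (metis sets.sigma_algebra_axioms space_borel)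
  ultimately show ?thesis
    unfolding mixture_def using A
    by (intro emeasure_measure_of_sigma) (auto simp: positive_def)
qed

definition belief :: "real measure \<Rightarrow> (nat \<Rightarrow> real) \<Rightarrow> (nat \<Rightarrow> real) \<Rightarrow> nat \<Rightarrow> real measure" where
  "belief P0 lam s t = mixture (lam t) P0 (empirical s (t - 1))"

definition alg_output :: "real \<Rightarrow> real measure \<Rightarrow> (nat \<Rightarrow> real) \<Rightarrow> (nat \<Rightarrow> real) \<Rightarrow> real \<Rightarrow> nat \<Rightarrow> real" where
  "alg_output R P0 lam s \<alpha> t = quantile R \<alpha> (belief P0 lam s t)"

definition regret :: "real \<Rightarrow> real measure \<Rightarrow> (nat \<Rightarrow> real) \<Rightarrow> (nat \<Rightarrow> real) \<Rightarrow> real \<Rightarrow> nat \<Rightarrow> real" where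
  "regret R P0 lam s \<alpha> T =
     (\<Sum>t = 1..T. qloss \<alpha> (alg_output R P0 lam s \<alpha> t) (s t))
   - (\<Sum>t = 1..T. qloss \<alpha> (quantile R \<alpha> (empirical s T)) (s t))"

definition prior_loss :: "real measure \<Rightarrow> real \<Rightarrow> real \<Rightarrow> real" where
  "prior_loss P0 \<alpha> r = (\<integral>x. qloss \<alpha> r x \<partial>P0)"

definition min_density :: "(real \<Rightarrow> real) \<Rightarrow> real \<Rightarrow> real \<Rightarrow> real" where
  "min_density p0 a b = Inf (p0 ` {min a b..max a b})"

text \<open>
  Only the values of \<open>p0\<close> on \<open>[0, R]\<close> matter. They are constrained pointwise rather than almost
  everywhere, since \<^const>\<open>min_density\<close> depends on the chosen version of the density.
\<close>

definition positive_density :: "real \<Rightarrow> real measure \<Rightarrow> (real \<Rightarrow> real) \<Rightarrow> bool" where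
  "positive_density R P0 p0 \<longleftrightarrow>
     prob_space P0 \<and>
     set_borel_measurable borel {0..R} p0 \<and>
     (\<forall>x\<in>{0..R}. p0 x > 0) \<and>
     P0 = density lborel (\<lambda>x. ennreal (indicator {0..R} x * p0 x))"

end

theory Submission
  imports Defs
begin

text \<open>
  With \<open>\<lambda>\<^sub>t = 1 / \<surd>t\<close> the algorithm is follow-the-regularised-leader: \<open>r\<^sub>t\<close> minimises
  \<open>\<Phi>\<^sub>t(r) = (\<Sum>i<t. l(r, r\<^sub>i\<^sup>*)) + (\<surd>t + 1) \<psi>(r)\<close>. Since the regularisation weight increases and
  \<open>\<psi> \<ge> 0\<close>, the regret is at most \<open>(\<surd>(T + 1) + 1) \<psi>(u)\<close> for the comparator \<open>u\<close>, plus the sum over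
  \<open>t\<close> of \<open>l(r\<^sub>t, r\<^sub>t\<^sup>*) - l(r, r\<^sub>t\<^sup>*) - (\<Phi>\<^sub>t(r) - \<Phi>\<^sub>t(r\<^sub>t))\<close> with \<open>r = r\<^sub>t\<^sub>+\<^sub>1\<close>. Let \<open>d\<close> be the part of the
  move from \<open>r\<^sub>t\<close> to \<open>r\<close> that lies between \<open>r\<^sub>t\<close> and \<open>r\<^sub>t\<^sup>*\<close>. The loss decreases by at most \<open>d\<close>, while
  \<open>\<Phi>\<^sub>t\<close> grows by at least \<open>(\<surd>t + 1) \<mu> d\<^sup>2 / 4\<close> because the prior has density at least \<open>\<mu>\<close> there; hence
  each summand is at most \<open>1 / (\<mu> (\<surd>t + 1))\<close>. For the uniform prior \<open>\<mu> = 1 / R\<close> and \<open>\<psi> \<le> R\<close>.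
\<close>

section \<open>The quantile loss: range, growth and decrease\<close>

lemma qloss_nonneg:
  assumes "\<alpha> \<in> {0..1}"
  shows "0 \<le> qloss \<alpha> r x"
  using assms by (auto simp: qloss_def mult_nonneg_nonpos)

lemma qloss_le:
  assumes "\<alpha> \<in> {0..1}" "r \<in> {0..R}" "x \<in> {0..R}"
  shows "qloss \<alpha> r x \<le> R"
proof (cases "r \<ge> x")
  case True
  have "(1 - \<alpha>) * (r - x) \<le> 1 * (r - x)"
    using assms True by (intro mult_right_mono) auto
  with True assms show ?thesis by (simp add: qloss_def)
next
  case False
  have "\<alpha> * (x - r) \<le> 1 * (x - r)"
    using assms False by (intro mult_right_mono) auto
  with False assms show ?thesis by (simp add: qloss_def algebra_simps)
qed

lemma qloss_measurable [measurable]: "qloss \<alpha> r \<in> borel_measurable borel"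
  unfolding qloss_def by measurable

text \<open>
  In the growth lemmas the point \<open>c\<close> cuts the move from \<open>a\<close> to \<open>b\<close> at the observation. Keeping only
  the mass on the half of the interval next to the quantile loses a constant factor but avoids
  integrating \<open>b - x\<close>.
\<close>

lemma qloss_growth_right:
  assumes "a \<le> c" "c \<le> b" "0 \<le> x"
  shows "(indicator {0..a} x - \<alpha>) * (b - a) + (c - a) / 2 * indicator {a<..(a + c) / 2} x
    \<le> qloss \<alpha> b x - qloss \<alpha> a x"
proof -
  consider "x \<le> a" | "a < x" "x \<le> (a + c) / 2" | "a < x" "(a + c) / 2 < x" "x \<le> b" | "b < x"
    by linarith
  then show ?thesis
    by cases (use assms in \<open>simp_all add: qloss_def field_simps\<close>)
qed

lemma qloss_growth_left:
  assumes "a \<le> c" "c \<le> b" "0 \<le> x"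
  shows "(\<alpha> - indicator {0..<b} x) * (b - a) + (b - c) / 2 * indicator {(b + c) / 2..<b} x
    \<le> qloss \<alpha> a x - qloss \<alpha> b x"
proof -
  consider "b \<le> x" | "x < b" "(b + c) / 2 \<le> x" | "a < x" "x < (b + c) / 2" "x < b" | "x \<le> a" "x < b"
    | "x \<le> a" "x = b"
    using assms by linarith
  then show ?thesis
    by cases (use assms in \<open>simp_all add: qloss_def field_simps\<close>)
qed

text \<open>Moving right, the loss falls at rate \<alpha> \<le> 1 until \<open>x\<close> is reached
  and rises afterwards, so only the part of the move before \<open>x\<close> can pay off;
  \<open>max a (min b x)\<close> is where that part ends.\<close>

lemma qloss_decrease_right:
  assumes "\<alpha> \<in> {0..1}" "a \<le> b"
  shows "qloss \<alpha> a x - qloss \<alpha> b x \<le> max a (min b x) - a"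
proof -
  have bound: "\<alpha> * d \<le> d" if "0 \<le> d" for d
    using assms that mult_right_mono[of \<alpha> 1 d] by auto
  consider "x \<le> a" | "a < x" "x \<le> b" | "b < x" by linarith
  then show ?thesis
  proof cases
    case 1
    with assms bound[of "b - a"] show ?thesis
      by (simp add: qloss_def min_def max_def algebra_simps)
  next
    case 2
    with assms bound[of "b - x"] bound[of "x - a"] show ?thesis
      by (simp add: qloss_def min_def max_def algebra_simps)
  next
    case 3
    with assms bound[of "b - a"] show ?thesis
      by (simp add: qloss_def min_def max_def algebra_simps)
  qed
qed

text \<open>Moving left, the loss falls at rate 1 - \<alpha> \<le> 1, and only while the move stays
  to the right of \<open>x\<close>.\<close>

lemma qloss_decrease_left:
  assumes "\<alpha> \<in> {0..1}" "a \<le> b"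
  shows "qloss \<alpha> b x - qloss \<alpha> a x \<le> b - min b (max a x)"
proof -
  have bound: "0 \<le> \<alpha> * d" if "0 \<le> d" for d
    using assms that by auto
  consider "x \<le> a" | "a < x" "x \<le> b" | "b < x" by linarith
  then show ?thesis
  proof cases
    case 1
    with assms bound[of "b - a"] show ?thesis
      by (simp add: qloss_def min_def max_def algebra_simps)
  next
    case 2
    with assms bound[of "b - x"] bound[of "x - a"] show ?thesis
      by (simp add: qloss_def min_def max_def algebra_simps)
  next
    case 3
    with assms bound[of "b - a"] show ?thesis
      by (simp add: qloss_def min_def max_def algebra_simps)
  qed
qed

section \<open>Quantiles and expected loss for distributions on \<open>[0, R]\<close>\<close>

locale interval_distribution = prob_space P for P :: "real measure" +
  fixes R :: real
  assumes sets_P [simp, measurable_cong]: "sets P = sets borel"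
    and AE_interval: "AE x in P. x \<in> {0..R}"
begin

lemma prob_interval: "prob {0..R} = 1"
  using AE_interval by (simp add: prob_eq_1)

lemma R_nonneg: "0 \<le> R"
  using prob_interval by (cases "0 \<le> R") auto

text \<open>The two mass bounds are the first-order optimality conditions for the expected loss: on
  the interval its right derivative at \<open>r\<close> is \<open>prob {0..r} - \<alpha>\<close> and
  its left derivative is \<open>prob {0..<r} - \<alpha>\<close>. They come from continuity of the
  measure from above and from below at the infimum \<open>q\<close>.\<close>

lemma
  assumes \<alpha>: "\<alpha> \<in> {0..1}"
  shows quantile_in_interval: "quantile R \<alpha> P \<in> {0..R}"
    and quantile_mass_ge: "\<alpha> \<le> prob {0..quantile R \<alpha> P}"
    and quantile_mass_le: "prob {0..<quantile R \<alpha> P} \<le> \<alpha>"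
proof -
  define S where "S = {x. x \<in> {0..R} \<and> \<alpha> \<le> prob {0..x}}"
  define q where "q = Inf S"
  have R: "R \<in> S" using \<alpha> prob_interval R_nonneg by (auto simp: S_def)
  have bdd: "bdd_below S" by (auto simp: S_def intro: bdd_belowI[of _ 0])
  have q0: "0 \<le> q" unfolding q_def using R by (intro cInf_greatest) (auto simp: S_def)
  have qR: "q \<le> R" unfolding q_def using R bdd by (rule cInf_lower)
  \<comment> \<open>These intervals shrink to \<open>{0..q}\<close> and each right end exceeds the
    infimum, so mass at least \<alpha> survives in the limit and the infimum is attained.\<close>
  have "(\<lambda>n. prob {0..q + 1 / real (Suc n)}) \<longlonglongrightarrow> prob (\<Inter>n. {0..q + 1 / real (Suc n)})"
    by (rule finite_Lim_measure_decseq) (auto simp: decseq_def frac_le intro: order_trans)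
  moreover have "(\<Inter>n. {0..q + 1 / real (Suc n)}) = {0..q}"
  proof (intro antisym subsetI)
    fix x assume x: "x \<in> (\<Inter>n. {0..q + 1 / real (Suc n)})"
    have "(\<lambda>n. q + 1 / real (Suc n)) \<longlonglongrightarrow> q + 0"
      by (intro tendsto_add tendsto_const LIMSEQ_Suc[OF lim_1_over_n])
    then have "x \<le> q + 0" by (rule LIMSEQ_le_const) (use x in auto)
    with x show "x \<in> {0..q}" by auto
  next
    fix x assume "x \<in> {0..q}"
    then show "x \<in> (\<Inter>n. {0..q + 1 / real (Suc n)})"
      by (auto intro: order_trans)
  qed
  moreover have "\<alpha> \<le> prob {0..q + 1 / real (Suc n)}" for n
  proof -
    have "q < q + 1 / real (Suc n)" by simp
    then obtain y where "y \<in> S" "y < q + 1 / real (Suc n)"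
      unfolding q_def using R by (metis cInf_lessD empty_iff)
    then have "\<alpha> \<le> prob {0..y}" "prob {0..y} \<le> prob {0..q + 1 / real (Suc n)}"
      by (auto simp: S_def intro!: finite_measure_mono)
    then show ?thesis by simp
  qed
  ultimately have mass: "\<alpha> \<le> prob {0..q}"
    by (intro LIMSEQ_le_const[of "\<lambda>n. prob {0..q + 1 / real (Suc n)}"]) auto
  have "quantile R \<alpha> P = q"
    unfolding quantile_def
    by (rule Least_equality) (use q0 qR mass bdd in \<open>auto simp: q_def S_def intro: cInf_lower\<close>)
  then show "quantile R \<alpha> P \<in> {0..R}" "\<alpha> \<le> prob {0..quantile R \<alpha> P}"
    using q0 qR mass by auto
  \<comment> \<open>These intervals increase to \<open>{0..<q}\<close>; their right ends lie below
    the infimum of \<open>S\<close>, which keeps each mass at most \<alpha>.\<close>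
  have "(\<lambda>n. prob {0..q - 1 / real (Suc n)}) \<longlonglongrightarrow> prob (\<Union>n. {0..q - 1 / real (Suc n)})"
    by (rule finite_Lim_measure_incseq) (auto simp: incseq_def frac_le intro: order_trans)
  moreover have "(\<Union>n. {0..q - 1 / real (Suc n)}) = {0..<q}"
  proof (intro antisym subsetI)
    fix x assume "x \<in> (\<Union>n. {0..q - 1 / real (Suc n)})"
    then obtain n where n: "0 \<le> x" "x \<le> q - 1 / real (Suc n)" by auto
    have "0 < 1 / real (Suc n)" by simp
    with n have "x < q" by linarith
    with n show "x \<in> {0..<q}" by simp
  next
    fix x assume x: "x \<in> {0..<q}"
    then obtain n where "inverse (real (Suc n)) < q - x"
      using reals_Archimedean[of "q - x"] by auto
    with x show "x \<in> (\<Union>n. {0..q - 1 / real (Suc n)})"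
      by (auto simp: inverse_eq_divide intro!: exI[of _ n])
  qed
  moreover have "prob {0..q - 1 / real (Suc n)} \<le> \<alpha>" for n
  proof (rule ccontr)
    assume neg: "\<not> prob {0..q - 1 / real (Suc n)} \<le> \<alpha>"
    \<comment> \<open>A negative right end would give an empty interval, whose mass 0 cannot exceed
      \<alpha>.\<close>
    with \<alpha> have "0 \<le> q - 1 / real (Suc n)" by (cases "0 \<le> q - 1 / real (Suc n)") auto
    moreover have pos: "0 < 1 / real (Suc n)" by simp
    then have "q - 1 / real (Suc n) \<le> R" using qR by linarith
    ultimately have "q - 1 / real (Suc n) \<in> S" using neg by (auto simp: S_def)
    then have "q \<le> q - 1 / real (Suc n)" unfolding q_def using bdd by (rule cInf_lower)
    with pos show False by linarith
  qed
  ultimately have "prob {0..<q} \<le> \<alpha>"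
    by (intro LIMSEQ_le_const2[of "\<lambda>n. prob {0..q - 1 / real (Suc n)}"]) auto
  with \<open>quantile R \<alpha> P = q\<close> show "prob {0..<quantile R \<alpha> P} \<le> \<alpha>" by simp
qed

lemma integrable_qloss:
  assumes "\<alpha> \<in> {0..1}" "r \<in> {0..R}"
  shows "integrable P (qloss \<alpha> r)"
proof (rule integrable_const_bound)
  show "AE x in P. norm (qloss \<alpha> r x) \<le> R"
    using AE_interval by eventually_elim (use assms in \<open>simp add: qloss_nonneg qloss_le\<close>)
qed simp

lemma prior_loss_nonneg:
  assumes "\<alpha> \<in> {0..1}"
  shows "0 \<le> prior_loss P \<alpha> r"
  unfolding prior_loss_def using assms by (intro Bochner_Integration.integral_nonneg qloss_nonneg)

lemma prior_loss_le:
  assumes "\<alpha> \<in> {0..1}" "r \<in> {0..R}"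
  shows "prior_loss P \<alpha> r \<le> R"
  unfolding prior_loss_def
proof (rule integral_le_const[OF integrable_qloss[OF assms]])
  show "AE x in P. qloss \<alpha> r x \<le> R"
    using AE_interval by eventually_elim (use assms in \<open>simp add: qloss_le\<close>)
qed

text \<open>Integrating the pointwise growth bound turns the slope into
  \<open>prob {0..a} - \<alpha>\<close>, the right derivative at \<open>a\<close>; the remaining
  term is the gain from mass just to the right of \<open>a\<close>.\<close>

lemma prior_loss_growth_right:
  assumes \<alpha>: "\<alpha> \<in> {0..1}" and "a \<in> {0..R}" "b \<in> {0..R}" "a \<le> c" "c \<le> b"
  shows "(prob {0..a} - \<alpha>) * (b - a) + (c - a) / 2 * prob {a<..(a + c) / 2}
    \<le> prior_loss P \<alpha> b - prior_loss P \<alpha> a"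
proof -
  have "(\<integral>x. (indicator {0..a} x - \<alpha>) * (b - a) + (c - a) / 2 * indicator {a<..(a + c) / 2} x \<partial>P)
      \<le> (\<integral>x. qloss \<alpha> b x - qloss \<alpha> a x \<partial>P)"
  proof (rule integral_mono_AE)
    show "AE x in P. (indicator {0..a} x - \<alpha>) * (b - a) + (c - a) / 2 * indicator {a<..(a + c) / 2} x
        \<le> qloss \<alpha> b x - qloss \<alpha> a x"
      using AE_interval by eventually_elim (rule qloss_growth_right, use assms in auto)
  qed (use assms in \<open>auto intro!: integrable_qloss Bochner_Integration.integrable_add
        Bochner_Integration.integrable_diff integrable_mult_left integrable_mult_right
        simp: less_top[symmetric]\<close>)
  then show ?thesis
    using assms by (simp add: prior_loss_def integrable_qloss prob_space less_top[symmetric])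
qed

text \<open>A move to the left is governed by the left derivative at \<open>b\<close>, which does
  not count an atom at \<open>b\<close>; hence the half-open intervals.\<close>

lemma prior_loss_growth_left:
  assumes \<alpha>: "\<alpha> \<in> {0..1}" and "a \<in> {0..R}" "b \<in> {0..R}" "a \<le> c" "c \<le> b"
  shows "(\<alpha> - prob {0..<b}) * (b - a) + (b - c) / 2 * prob {(b + c) / 2..<b}
    \<le> prior_loss P \<alpha> a - prior_loss P \<alpha> b"
proof -
  have "(\<integral>x. (\<alpha> - indicator {0..<b} x) * (b - a) + (b - c) / 2 * indicator {(b + c) / 2..<b} x \<partial>P)
      \<le> (\<integral>x. qloss \<alpha> a x - qloss \<alpha> b x \<partial>P)"
  proof (rule integral_mono_AE)
    show "AE x in P. (\<alpha> - indicator {0..<b} x) * (b - a) + (b - c) / 2 * indicator {(b + c) / 2..<b} x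
        \<le> qloss \<alpha> a x - qloss \<alpha> b x"
      using AE_interval by eventually_elim (rule qloss_growth_left, use assms in auto)
  qed (use assms in \<open>auto intro!: integrable_qloss Bochner_Integration.integrable_add
        Bochner_Integration.integrable_diff integrable_mult_left integrable_mult_right
        simp: less_top[symmetric]\<close>)
  then show ?thesis
    using assms by (simp add: prior_loss_def integrable_qloss prob_space less_top[symmetric])
qed

end

section \<open>Empirical distributions and two arithmetic facts\<close>

lemma sets_empirical [simp]: "sets (empirical s n) = sets borel"
  by (simp add: empirical_def)

lemma prob_space_empirical:
  assumes "n \<ge> 1"
  shows "prob_space (empirical s n)"
proof -
  have "prob_space (uniform_count_measure {1..n})"
    using assms by (intro prob_space_uniform_count_measure) auto
  moreover have "s \<in> measurable (uniform_count_measure {1..n}) borel"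
    by (rule measurableI) (auto simp: space_uniform_count_measure sets_uniform_count_measure)
  ultimately show ?thesis
    unfolding empirical_def by (rule prob_space.prob_space_distr)
qed

lemma interval_distributionI:
  assumes "prob_space P" "sets P = sets borel" "measure P {0..R} = 1"
  shows "interval_distribution P R"
proof -
  interpret prob_space P by fact
  show ?thesis
    by unfold_locales (use assms AE_in_set_eq_1[of "{0..R}"] in auto)
qed

lemma interval_distribution_empirical:
  assumes "n \<ge> 1" "\<And>i. i \<in> {1..n} \<Longrightarrow> s i \<in> {0..R}"
  shows "interval_distribution (empirical s n) R"
proof (rule interval_distributionI)
  have "{i \<in> {1..n}. s i \<in> {0..R}} = {1..n}" using assms by blast
  then show "measure (empirical s n) {0..R} = 1"
    using assms by (simp add: measure_empirical)
qed (use assms in \<open>auto intro: prob_space_empirical\<close>)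

text \<open>The left side is (\<surd>t + 1)(\<surd>t - 1). The resulting factor t - 1 cancels the
  normalisation of the empirical distribution when the belief is rescaled.\<close>

lemma sqrt_belief_weights:
  assumes "t \<ge> 1"
  shows "sqrt (real t) * (sqrt (real t) + 1) * (1 - 1 / sqrt (real t)) = real (t - 1)"
  using assms by (simp add: field_simps of_nat_diff)

text \<open>The concave quadratic in \<open>d\<close> peaks at \<open>d = 2 / k\<close>. It bounds a
  gain \<open>d\<close> in loss set against a quadratic growth of the potential.\<close>

lemma linear_minus_quadratic_le:
  fixes d k :: real
  assumes "k > 0"
  shows "d - k * (d / 2 * (d / 2)) \<le> 1 / k"
proof -
  have "0 \<le> (k * d - 2)\<^sup>2" by simp
  then show ?thesis using assms by (simp add: field_simps power2_eq_square)
qed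

abbreviation (input) sqrt_step :: "nat \<Rightarrow> real" where
  "sqrt_step \<equiv> (\<lambda>t. 1 / sqrt (real t))"

section \<open>The belief of a round and its potential\<close>

context
  fixes P0 :: "real measure" and R :: real
  assumes prior: "interval_distribution P0 R"
begin

interpretation prior: interval_distribution P0 R
  by (rule prior)

lemma emeasure_belief:
  assumes "A \<in> sets borel"
  shows "emeasure (belief P0 sqrt_step s t) A = ennreal (1 / sqrt (real t)) * emeasure P0 A
    + ennreal (1 - 1 / sqrt (real t)) * emeasure (empirical s (t - 1)) A"
  using assms by (simp add: belief_def emeasure_mixture)

lemma prob_space_belief:
  assumes "t \<ge> 1"
  shows "prob_space (belief P0 sqrt_step s t)"
proof (rule prob_spaceI)
  have "space (belief P0 sqrt_step s t) = UNIV"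
    by (metis belief_def sets_eq_imp_space_eq sets_mixture space_borel)
  moreover have "emeasure P0 UNIV = 1"
    using prior.emeasure_space_1 by (metis prior.sets_P sets_eq_imp_space_eq space_borel)
  moreover have "ennreal (1 / sqrt (real t)) + ennreal (1 - 1 / sqrt (real t)) = 1"
    using assms by (subst ennreal_plus[symmetric]) auto
  \<comment> \<open>For \<open>t = 1\<close> the empirical part is the null measure, but its weight
    is 0 and the prior alone supplies the total mass.\<close>
  moreover have "emeasure (empirical s (t - 1)) UNIV = 1" if "t \<noteq> 1"
    using prob_space.emeasure_space_1[OF prob_space_empirical[of "t - 1" s]] that assms
    by (simp add: empirical_def)
  ultimately show "emeasure (belief P0 sqrt_step s t) (space (belief P0 sqrt_step s t)) = 1"
    by (cases "t = 1") (simp_all add: emeasure_belief)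
qed

text \<open>
  Rescaling by \<open>\<surd>t (\<surd>t + 1)\<close> gives every past observation weight 1 and turns the
  regularisation weight of the prior into \<open>\<surd>t + 1\<close>, which increases with \<open>t\<close>.
\<close>

lemma measure_belief:
  assumes t: "t \<ge> 1" and A: "A \<in> sets borel"
  shows "sqrt (real t) * (sqrt (real t) + 1) * measure (belief P0 sqrt_step s t) A =
    (sqrt (real t) + 1) * measure P0 A + (\<Sum>i = 1..<t. indicator A (s i))"
proof -
  interpret B: prob_space "belief P0 sqrt_step s t" by (rule prob_space_belief[OF t])
  have E: "emeasure (empirical s (t - 1)) A = ennreal (measure (empirical s (t - 1)) A)" if "t \<noteq> 1"
    using prob_space_empirical[of "t - 1" s] that t
    by (simp add: finite_measure.emeasure_eq_measure prob_space.finite_measure)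
  have "ennreal (B.prob A) = ennreal (1 / sqrt (real t)) * ennreal (measure P0 A)
      + ennreal (1 - 1 / sqrt (real t)) * emeasure (empirical s (t - 1)) A"
    unfolding B.emeasure_eq_measure[symmetric] prior.emeasure_eq_measure[symmetric]
    by (rule emeasure_belief[OF A])
  also have "\<dots> = ennreal (1 / sqrt (real t) * measure P0 A
      + (1 - 1 / sqrt (real t)) * measure (empirical s (t - 1)) A)"
  proof (cases "t = 1")
    case False
    then show ?thesis
      using t E by (subst ennreal_plus) (simp_all add: ennreal_mult[symmetric])
  qed simp
  finally have eq: "B.prob A = 1 / sqrt (real t) * measure P0 A
      + (1 - 1 / sqrt (real t)) * measure (empirical s (t - 1)) A"
    using t by (subst (asm) ennreal_inj) auto
  \<comment> \<open>Undoing the normalisation turns the empirical frequency into a count; for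
    \<open>t = 1\<close> both sides are 0.\<close>
  have "real (t - 1) * measure (empirical s (t - 1)) A = (\<Sum>i = 1..<t. indicator A (s i))"
  proof (cases "t = 1")
    case False
    have "{i \<in> {1..t - 1}. s i \<in> A} = {i \<in> {1..<t}. s i \<in> A}" by auto
    moreover have "(\<Sum>i = 1..<t. indicator A (s i)) = real (card {i \<in> {1..<t}. s i \<in> A})"
      by (simp add: indicator_def sum.If_cases Int_def)
    ultimately show ?thesis using False t A by (simp add: measure_empirical)
  qed simp
  moreover have "sqrt (real t) * (sqrt (real t) + 1) * B.prob A = (sqrt (real t) + 1) * measure P0 A
      + (sqrt (real t) * (sqrt (real t) + 1) * (1 - 1 / sqrt (real t)))
        * measure (empirical s (t - 1)) A"
  proof -
    have "w * (w + 1) * (1 / w * a + (1 - 1 / w) * b) = (w + 1) * a + w * (w + 1) * (1 - 1 / w) * b"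
      if "w \<noteq> 0" for w a b :: real
      using that by (simp add: field_simps)
    then show ?thesis unfolding eq using t by simp
  qed
  ultimately show ?thesis
    unfolding sqrt_belief_weights[OF t] by simp
qed

lemma interval_distribution_belief:
  assumes t: "t \<ge> 1" and s: "\<And>i. i \<in> {1..<t} \<Longrightarrow> s i \<in> {0..R}"
  shows "interval_distribution (belief P0 sqrt_step s t) R"
proof (rule interval_distributionI)
  have "(\<Sum>i = 1..<t. indicator {0..R} (s i)) = (\<Sum>i = 1..<t. 1 :: real)"
    using s by (intro sum.cong) auto
  \<comment> \<open>The prior contributes \<surd>t + 1 and the past observations t - 1, which
    together equal \<surd>t (\<surd>t + 1).\<close>
  then have "sqrt (real t) * (sqrt (real t) + 1) * measure (belief P0 sqrt_step s t) {0..R}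
      = sqrt (real t) * (sqrt (real t) + 1) * 1"
    using t measure_belief[OF t, of "{0..R}" s]
    by (simp add: prior.prob_interval of_nat_diff algebra_simps)
  moreover have "sqrt (real t) * (sqrt (real t) + 1) \<noteq> 0"
    using t by (simp add: add_nonneg_eq_0_iff)
  ultimately show "measure (belief P0 sqrt_step s t) {0..R} = 1"
    by (simp only: mult_cancel_left) simp
qed (use prob_space_belief[OF t] in \<open>simp_all add: belief_def\<close>)

text \<open>For \<open>t \<ge> 1\<close> this is \<surd>t (\<surd>t + 1) times the expected loss
  under the belief of round \<open>t\<close>, so the quantile output minimises it.\<close>

definition potential :: "real \<Rightarrow> (nat \<Rightarrow> real) \<Rightarrow> nat \<Rightarrow> real \<Rightarrow> real" where
  "potential \<alpha> s t r =
     (\<Sum>i = 1..<t. qloss \<alpha> r (s i)) + (sqrt (real t) + 1) * prior_loss P0 \<alpha> r"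

section \<open>Growth of the potential around the output, and stability of one round\<close>

context
  fixes \<alpha> :: real and s :: "nat \<Rightarrow> real" and t :: nat and q :: real
  assumes \<alpha>: "\<alpha> \<in> {0..1}" and t: "t \<ge> 1" and s: "\<And>i. i \<in> {1..<t} \<Longrightarrow> s i \<in> {0..R}"
  defines "q \<equiv> alg_output R P0 sqrt_step s \<alpha> t"
begin

interpretation B: interval_distribution "belief P0 sqrt_step s t" R
  by (rule interval_distribution_belief[OF t s])

lemma alg_output_in_interval: "q \<in> {0..R}"
  unfolding q_def alg_output_def by (rule B.quantile_in_interval[OF \<alpha>])

text \<open>The first-order terms of past losses and prior loss add up to a multiple of
  \<open>B.prob {0..q} - \<alpha>\<close>, nonnegative since \<open>q\<close> is a quantile of the
  belief. What is left is the second-order term of the prior.\<close>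

lemma potential_growth_right:
  assumes b: "b \<in> {0..R}" "q \<le> c" "c \<le> b"
  shows "(sqrt (real t) + 1) * ((c - q) / 2 * measure P0 {q<..(q + c) / 2})
    \<le> potential \<alpha> s t b - potential \<alpha> s t q"
proof -
  let ?\<eta> = "sqrt (real t) + 1"
  let ?N = "\<Sum>i = 1..<t. indicator {0..q} (s i) :: real"
  have "\<alpha> \<le> B.prob {0..q}"
    unfolding q_def alg_output_def by (rule B.quantile_mass_ge[OF \<alpha>])
  then have "sqrt (real t) * ?\<eta> * \<alpha> \<le> sqrt (real t) * ?\<eta> * B.prob {0..q}"
    by (intro mult_left_mono) auto
  also have "\<dots> = ?\<eta> * measure P0 {0..q} + ?N"
    by (rule measure_belief[OF t]) simp
  finally have "0 \<le> ?\<eta> * measure P0 {0..q} + ?N - sqrt (real t) * ?\<eta> * \<alpha>" by simp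
  then have "0 \<le> (?\<eta> * measure P0 {0..q} + ?N - sqrt (real t) * ?\<eta> * \<alpha>) * (b - q)"
    using b by (intro mult_nonneg_nonneg) auto
  \<comment> \<open>This splits the \<alpha>-term between the t - 1 past observations and the prior
    with its weight \<open>?\<eta>\<close>.\<close>
  also have "sqrt (real t) * ?\<eta> = real (t - 1) + ?\<eta>"
    using t by (simp add: algebra_simps of_nat_diff)
  finally have 1: "0 \<le> ?\<eta> * ((measure P0 {0..q} - \<alpha>) * (b - q)) + (?N - real (t - 1) * \<alpha>) * (b - q)"
    by (simp add: algebra_simps)
  have "(?N - real (t - 1) * \<alpha>) * (b - q) = (\<Sum>i = 1..<t. (indicator {0..q} (s i) - \<alpha>) * (b - q))"
    by (simp add: sum_subtractf sum_distrib_right[symmetric])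
  also have "\<dots> \<le> (\<Sum>i = 1..<t. qloss \<alpha> b (s i) - qloss \<alpha> q (s i))"
  proof (rule sum_mono)
    fix i assume "i \<in> {1..<t}"
    \<comment> \<open>With the cut at \<open>q\<close> the mass term vanishes: past losses
      contribute only their slope.\<close>
    from qloss_growth_right[of q q b "s i" \<alpha>] s[OF this] b
    show "(indicator {0..q} (s i) - \<alpha>) * (b - q) \<le> qloss \<alpha> b (s i) - qloss \<alpha> q (s i)" by simp
  qed
  finally have 2: "(?N - real (t - 1) * \<alpha>) * (b - q)
      \<le> (\<Sum>i = 1..<t. qloss \<alpha> b (s i)) - (\<Sum>i = 1..<t. qloss \<alpha> q (s i))"
    by (simp add: sum_subtractf)
  have "?\<eta> * ((measure P0 {0..q} - \<alpha>) * (b - q) + (c - q) / 2 * measure P0 {q<..(q + c) / 2})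
      \<le> ?\<eta> * (prior_loss P0 \<alpha> b - prior_loss P0 \<alpha> q)"
    using prior.prior_loss_growth_right[OF \<alpha> alg_output_in_interval b]
    by (intro mult_left_mono) auto
  then show ?thesis
    using 1 2 unfolding potential_def distrib_left right_diff_distrib by linarith
qed

text \<open>The slope is now a multiple of \<open>\<alpha> - B.prob {0..<q}\<close>, nonnegative
  because the mass strictly below a quantile is at most \<alpha>.\<close>

lemma potential_growth_left:
  assumes a: "a \<in> {0..R}" "a \<le> c" "c \<le> q"
  shows "(sqrt (real t) + 1) * ((q - c) / 2 * measure P0 {(q + c) / 2..<q})
    \<le> potential \<alpha> s t a - potential \<alpha> s t q"
proof -
  let ?\<eta> = "sqrt (real t) + 1"
  let ?N = "\<Sum>i = 1..<t. indicator {0..<q} (s i) :: real"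
  have "B.prob {0..<q} \<le> \<alpha>"
    unfolding q_def alg_output_def by (rule B.quantile_mass_le[OF \<alpha>])
  then have "sqrt (real t) * ?\<eta> * B.prob {0..<q} \<le> sqrt (real t) * ?\<eta> * \<alpha>"
    by (intro mult_left_mono) auto
  moreover have "sqrt (real t) * ?\<eta> * B.prob {0..<q} = ?\<eta> * measure P0 {0..<q} + ?N"
    by (rule measure_belief[OF t]) simp
  ultimately have "0 \<le> sqrt (real t) * ?\<eta> * \<alpha> - (?\<eta> * measure P0 {0..<q} + ?N)" by simp
  then have "0 \<le> (sqrt (real t) * ?\<eta> * \<alpha> - (?\<eta> * measure P0 {0..<q} + ?N)) * (q - a)"
    using a by (intro mult_nonneg_nonneg) auto
  also have "sqrt (real t) * ?\<eta> = real (t - 1) + ?\<eta>"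
    using t by (simp add: algebra_simps of_nat_diff)
  finally have 1: "0 \<le> ?\<eta> * ((\<alpha> - measure P0 {0..<q}) * (q - a)) + (real (t - 1) * \<alpha> - ?N) * (q - a)"
    by (simp add: algebra_simps)
  have "(real (t - 1) * \<alpha> - ?N) * (q - a) = (\<Sum>i = 1..<t. (\<alpha> - indicator {0..<q} (s i)) * (q - a))"
    by (simp add: sum_subtractf sum_distrib_right[symmetric])
  also have "\<dots> \<le> (\<Sum>i = 1..<t. qloss \<alpha> a (s i) - qloss \<alpha> q (s i))"
  proof (rule sum_mono)
    fix i assume "i \<in> {1..<t}"
    from qloss_growth_left[of a q q "s i" \<alpha>] s[OF this] a
    show "(\<alpha> - indicator {0..<q} (s i)) * (q - a) \<le> qloss \<alpha> a (s i) - qloss \<alpha> q (s i)" by simp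
  qed
  finally have 2: "(real (t - 1) * \<alpha> - ?N) * (q - a)
      \<le> (\<Sum>i = 1..<t. qloss \<alpha> a (s i)) - (\<Sum>i = 1..<t. qloss \<alpha> q (s i))"
    by (simp add: sum_subtractf)
  have "?\<eta> * ((\<alpha> - measure P0 {0..<q}) * (q - a) + (q - c) / 2 * measure P0 {(q + c) / 2..<q})
      \<le> ?\<eta> * (prior_loss P0 \<alpha> a - prior_loss P0 \<alpha> q)"
    using prior.prior_loss_growth_left[OF \<alpha> a(1) alg_output_in_interval a(2,3)]
    by (intro mult_left_mono) auto
  then show ?thesis
    using 1 2 unfolding potential_def distrib_left right_diff_distrib by linarith
qed

lemma alg_output_minimizes_potential:
  assumes "r \<in> {0..R}"
  shows "potential \<alpha> s t q \<le> potential \<alpha> s t r"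
  \<comment> \<open>Cutting at \<open>q\<close> reduces both lower bounds to 0.\<close>
  using potential_growth_right[of r q] potential_growth_left[of r q] assms
  by (cases "q \<le> r") auto

text \<open>The prior enters only through the mass of intervals that start at \<open>q\<close> and
  run towards \<open>x\<close>, so \<mu> need only bound the density between these two points. The
  point \<open>r\<close> is arbitrary; it will be the next output.\<close>

lemma stability:
  assumes r: "r \<in> {0..R}" and x: "x \<in> {0..R}" and \<mu>: "\<mu> > 0"
    and mass_right: "\<And>c. q \<le> c \<Longrightarrow> c \<le> x \<Longrightarrow> \<mu> * (c - q) \<le> measure P0 {q<..c}"
    and mass_left: "\<And>c. c \<le> q \<Longrightarrow> x \<le> c \<Longrightarrow> \<mu> * (q - c) \<le> measure P0 {c..<q}"
  shows "qloss \<alpha> q x - qloss \<alpha> r x \<le>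
    potential \<alpha> s t r - potential \<alpha> s t q + 1 / (\<mu> * (sqrt (real t) + 1))"
proof -
  let ?\<eta> = "sqrt (real t) + 1"
  have \<eta>: "0 < \<mu> * ?\<eta>" using \<mu> by (simp add: add_nonneg_pos)
  consider "q \<le> r" | "r \<le> q" by linarith
  then show ?thesis
  proof cases
    case 1
    define c where "c = max q (min r x)"
    have c: "q \<le> c" "c \<le> r" using 1 by (auto simp: c_def)
    have "\<mu> * ((c - q) / 2) \<le> measure P0 {q<..(q + c) / 2}"
    \<comment> \<open>If \<open>c = q\<close> both sides are 0. Otherwise \<open>c \<le> x\<close>,
      so the midpoint is within the range of \<open>mass_right\<close>.\<close>
    proof (cases "c = q")
      case False
      then have "(q + c) / 2 \<le> x" using c by (auto simp: c_def)
      with mass_right[of "(q + c) / 2"] c show ?thesis by (simp add: field_simps)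
    qed simp
    then have "?\<eta> * ((c - q) / 2 * (\<mu> * ((c - q) / 2)))
        \<le> ?\<eta> * ((c - q) / 2 * measure P0 {q<..(q + c) / 2})"
      using c by (intro mult_left_mono) auto
    moreover note potential_growth_right[OF r c]
    moreover have "qloss \<alpha> q x - qloss \<alpha> r x \<le> c - q"
      unfolding c_def by (rule qloss_decrease_right[OF \<alpha> 1])
    moreover have "?\<eta> * ((c - q) / 2 * (\<mu> * ((c - q) / 2))) = \<mu> * ?\<eta> * ((c - q) / 2 * ((c - q) / 2))"
      by (simp only: mult_ac)
    ultimately show ?thesis
      using linear_minus_quadratic_le[OF \<eta>, of "c - q"] by linarith
  next
    case 2
    define c where "c = min q (max r x)"
    have c: "r \<le> c" "c \<le> q" using 2 by (auto simp: c_def)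
    have "\<mu> * ((q - c) / 2) \<le> measure P0 {(q + c) / 2..<q}"
    proof (cases "c = q")
      case False
      then have "x \<le> (q + c) / 2" using c by (auto simp: c_def)
      with mass_left[of "(q + c) / 2"] c show ?thesis by (simp add: field_simps)
    qed simp
    then have "?\<eta> * ((q - c) / 2 * (\<mu> * ((q - c) / 2)))
        \<le> ?\<eta> * ((q - c) / 2 * measure P0 {(q + c) / 2..<q})"
      using c by (intro mult_left_mono) auto
    moreover note potential_growth_left[OF r c]
    moreover have "qloss \<alpha> q x - qloss \<alpha> r x \<le> q - c"
      unfolding c_def by (rule qloss_decrease_left[OF \<alpha> 2])
    moreover have "?\<eta> * ((q - c) / 2 * (\<mu> * ((q - c) / 2))) = \<mu> * ?\<eta> * ((q - c) / 2 * ((q - c) / 2))"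
      by (simp only: mult_ac)
    ultimately show ?thesis
      using linear_minus_quadratic_le[OF \<eta>, of "q - c"] by linarith
  qed
qed

end

section \<open>Telescoping over the rounds\<close>

text \<open>In the induction step, \<open>stable\<close> trades the point played for the next one at
  cost \<open>\<delta>\<close>; the loss just incurred is then absorbed into the next potential,
  whose regularisation weight is no smaller.\<close>

lemma potential_telescope:
  assumes \<alpha>: "\<alpha> \<in> {0..1}"
    and stable: "\<And>t. t \<in> {1..T} \<Longrightarrow> qloss \<alpha> (r t) (s t) - qloss \<alpha> (r (Suc t)) (s t) \<le>
      potential \<alpha> s t (r (Suc t)) - potential \<alpha> s t (r t) + \<delta> t"
  shows "(\<Sum>t = 1..T. qloss \<alpha> (r t) (s t)) \<le> potential \<alpha> s (Suc T) (r (Suc T)) + (\<Sum>t = 1..T. \<delta> t)"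
  using stable
proof (induction T)
  case 0
  show ?case using prior.prior_loss_nonneg[OF \<alpha>] by (simp add: potential_def)
next
  case (Suc T)
  let ?r = "r (Suc (Suc T))"
  have "(sqrt (real (Suc T)) + 1) * prior_loss P0 \<alpha> ?r \<le> (sqrt (real (Suc (Suc T))) + 1) * prior_loss P0 \<alpha> ?r"
    using prior.prior_loss_nonneg[OF \<alpha>] by (intro mult_right_mono) auto
  then have "potential \<alpha> s (Suc T) ?r + qloss \<alpha> ?r (s (Suc T)) \<le> potential \<alpha> s (Suc (Suc T)) ?r"
    by (simp add: potential_def)
  moreover have "(\<Sum>t = 1..T. qloss \<alpha> (r t) (s t)) \<le> potential \<alpha> s (Suc T) (r (Suc T)) + (\<Sum>t = 1..T. \<delta> t)"
    by (rule Suc.IH) (use Suc.prems in auto)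
  moreover note Suc.prems[of "Suc T"]
  ultimately show ?case by simp
qed

lemma regret_le:
  assumes \<alpha>: "\<alpha> \<in> {0..1}" and T: "T \<ge> 1" and s: "\<And>t. t \<in> {1..T} \<Longrightarrow> s t \<in> {0..R}"
    and q_def: "\<And>t. q t = alg_output R P0 sqrt_step s \<alpha> t"
    and \<mu>: "\<And>t. t \<in> {1..T} \<Longrightarrow> \<mu> t > 0"
    and mass_right: "\<And>t c. t \<in> {1..T} \<Longrightarrow> q t \<le> c \<Longrightarrow> c \<le> s t \<Longrightarrow> \<mu> t * (c - q t) \<le> measure P0 {q t<..c}"
    and mass_left: "\<And>t c. t \<in> {1..T} \<Longrightarrow> c \<le> q t \<Longrightarrow> s t \<le> c \<Longrightarrow> \<mu> t * (q t - c) \<le> measure P0 {c..<q t}"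
  shows "regret R P0 sqrt_step s \<alpha> T \<le>
    3 * (prior_loss P0 \<alpha> (quantile R \<alpha> (empirical s T)) * sqrt (real T))
    + (\<Sum>t = 1..T. 1 / (\<mu> t * sqrt (real t)))"
proof -
  define u where "u = quantile R \<alpha> (empirical s T)"
  interpret E: interval_distribution "empirical s T" R
    by (rule interval_distribution_empirical[OF T s])
  have u: "u \<in> {0..R}" unfolding u_def by (rule E.quantile_in_interval[OF \<alpha>])
  have s': "s i \<in> {0..R}" if "i \<in> {1..<t}" "t \<le> Suc T" for i t
    using s[of i] that by auto
  \<comment> \<open>Round \<open>T + 1\<close> is not played, but its output depends only on the
    first \<open>T\<close> observations and closes the telescope.\<close>
  have q: "q t \<in> {0..R}" if "t \<in> {1..Suc T}" for t
    unfolding q_def by (rule alg_output_in_interval[OF \<alpha>]) (use that s' in auto)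
  have "(\<Sum>t = 1..T. qloss \<alpha> (q t) (s t))
      \<le> potential \<alpha> s (Suc T) (q (Suc T)) + (\<Sum>t = 1..T. 1 / (\<mu> t * (sqrt (real t) + 1)))"
  proof (rule potential_telescope[OF \<alpha>])
    fix t assume t: "t \<in> {1..T}"
    show "qloss \<alpha> (q t) (s t) - qloss \<alpha> (q (Suc t)) (s t) \<le>
        potential \<alpha> s t (q (Suc t)) - potential \<alpha> s t (q t) + 1 / (\<mu> t * (sqrt (real t) + 1))"
      unfolding q_def[of t]
      by (rule stability[OF \<alpha>])
        (use t s s' q \<mu> mass_right[OF t] mass_left[OF t] in \<open>auto simp: q_def\<close>)
  qed
  also have "potential \<alpha> s (Suc T) (q (Suc T)) \<le> potential \<alpha> s (Suc T) u"
    unfolding q_def by (rule alg_output_minimizes_potential[OF \<alpha>]) (use s' u in auto)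
  also have "potential \<alpha> s (Suc T) u = (\<Sum>t = 1..T. qloss \<alpha> u (s t))
      + (sqrt (real (Suc T)) + 1) * prior_loss P0 \<alpha> u"
    by (simp add: potential_def atLeastLessThanSuc_atLeastAtMost)
  also have "(sqrt (real (Suc T)) + 1) * prior_loss P0 \<alpha> u \<le> (3 * sqrt (real T)) * prior_loss P0 \<alpha> u"
  proof (intro mult_right_mono prior.prior_loss_nonneg \<alpha>)
    \<comment> \<open>The factor 3 arises as 2 + 1: for \<open>T \<ge> 1\<close>, \<surd>(T + 1)
      \<le> 2 \<surd>T and 1 \<le> \<surd>T.\<close>
    have "sqrt (real (Suc T)) \<le> sqrt (4 * real T)" using T by (intro real_sqrt_le_mono) auto
    then have "sqrt (real (Suc T)) \<le> 2 * sqrt (real T)" by (simp add: real_sqrt_mult)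
    moreover have "1 \<le> sqrt (real T)" using T by simp
    ultimately show "sqrt (real (Suc T)) + 1 \<le> 3 * sqrt (real T)" by linarith
  qed
  also have "(\<Sum>t = 1..T. 1 / (\<mu> t * (sqrt (real t) + 1))) \<le> (\<Sum>t = 1..T. 1 / (\<mu> t * sqrt (real t)))"
    using \<mu> by (intro sum_mono divide_left_mono mult_left_mono mult_pos_pos)
      (auto simp: add_pos_nonneg less_imp_le)
  finally show ?thesis
    by (simp add: regret_def q_def u_def algebra_simps)
qed

end

section \<open>Priors with a density\<close>

lemma positive_density_interval_distribution:
  assumes "positive_density R P0 p0"
  shows "interval_distribution P0 R"
proof -
  interpret prob_space P0 using assms unfolding positive_density_def by blast
  have P0: "P0 = density lborel (\<lambda>x. ennreal (indicator {0..R} x * p0 x))"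
    and m: "(\<lambda>x. indicator {0..R} x * p0 x) \<in> borel_measurable borel"
    using assms by (auto simp: positive_density_def set_borel_measurable_def)
  show ?thesis
  proof unfold_locales
    show "sets P0 = sets borel" by (subst P0) simp
    have "AE x in density lborel (\<lambda>x. ennreal (indicator {0..R} x * p0 x)). x \<in> {0..R}"
      using m by (subst AE_density) (auto simp: indicator_def split: if_splits)
    then show "AE x in P0. x \<in> {0..R}" by (simp only: P0[symmetric])
  qed
qed

text \<open>Stated for a Borel set with its length \<open>d\<close>, so that it covers intervals
  half-open on either side.\<close>

lemma positive_density_mass_ge:
  assumes "positive_density R P0 p0" and A: "A \<in> sets borel" "A \<subseteq> {0..R}"
    and \<mu>: "\<And>x. x \<in> A \<Longrightarrow> \<mu> \<le> p0 x" and "0 \<le> \<mu>" and d: "emeasure lborel A = ennreal d" "0 \<le> d"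
  shows "\<mu> * d \<le> measure P0 A"
proof -
  interpret prob_space P0 using assms unfolding positive_density_def by blast
  have P0: "P0 = density lborel (\<lambda>x. ennreal (indicator {0..R} x * p0 x))"
    and m [measurable]: "(\<lambda>x. indicator {0..R} x * p0 x) \<in> borel_measurable borel"
    using assms by (auto simp: positive_density_def set_borel_measurable_def)
  have "ennreal (\<mu> * d) = (\<integral>\<^sup>+x. ennreal \<mu> * indicator A x \<partial>lborel)"
    using A \<open>0 \<le> \<mu>\<close> d by (simp add: nn_integral_cmult_indicator ennreal_mult)
  also have "\<dots> \<le> (\<integral>\<^sup>+x. ennreal (indicator {0..R} x * p0 x) * indicator A x \<partial>lborel)"
    using A \<mu> by (intro nn_integral_mono) (auto simp: indicator_def intro!: ennreal_leI)
  also have "\<dots> = emeasure P0 A"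
    using A by (subst P0, subst emeasure_density) auto
  finally show ?thesis by (simp add: emeasure_eq_measure)
qed

text \<open>Allowing any positive lower bound \<mu> serves both the infimum
  \<open>min_density\<close> and the constant 1 / R of the uniform prior.\<close>

lemma regret_le_density:
  assumes dens: "positive_density R P0 p0"
    and \<alpha>: "\<alpha> \<in> {0..1}" and T: "T \<ge> 1" and s: "\<And>t. t \<in> {1..T} \<Longrightarrow> s t \<in> {0..R}"
    and q_def: "\<And>t. q t = alg_output R P0 sqrt_step s \<alpha> t"
    and pos: "\<And>t. t \<in> {1..T} \<Longrightarrow> \<mu> t > 0"
    and lower: "\<And>t x. t \<in> {1..T} \<Longrightarrow> x \<in> {0..R} \<Longrightarrow> x \<in> {min (q t) (s t)..max (q t) (s t)} \<Longrightarrow> \<mu> t \<le> p0 x"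
  shows "regret R P0 sqrt_step s \<alpha> T \<le>
    3 * (prior_loss P0 \<alpha> (quantile R \<alpha> (empirical s T)) * sqrt (real T))
    + (\<Sum>t = 1..T. 1 / (\<mu> t * sqrt (real t)))"
proof (rule regret_le[OF positive_density_interval_distribution[OF dens] \<alpha> T s q_def pos])
  fix t c assume t: "t \<in> {1..T}"
  have q: "q t \<in> {0..R}"
    unfolding q_def
    by (rule alg_output_in_interval[OF positive_density_interval_distribution[OF dens] \<alpha>])
      (use t s in auto)
  note st = s[OF t]
  show "\<mu> t * (c - q t) \<le> measure P0 {q t<..c}" if "q t \<le> c" "c \<le> s t"
    by (rule positive_density_mass_ge[OF dens]) (use q st that t pos[OF t] in \<open>auto intro!: lower\<close>)
  show "\<mu> t * (q t - c) \<le> measure P0 {c..<q t}" if "c \<le> q t" "s t \<le> c"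
    by (rule positive_density_mass_ge[OF dens]) (use q st that t pos[OF t] in \<open>auto intro!: lower\<close>)
qed auto

section \<open>The uniform prior and the final constants\<close>

lemma positive_density_uniform:
  assumes "R > 0"
  shows "positive_density R (uniform_measure lborel {0..R}) (\<lambda>_. 1 / R)"
  unfolding positive_density_def
proof (intro conjI)
  show "prob_space (uniform_measure lborel {0..R})"
    using assms by (intro prob_space_uniform_measure) auto
  show "uniform_measure lborel {0..R} = density lborel (\<lambda>x. ennreal (indicator {0..R} x * (1 / R)))"
    unfolding uniform_measure_def
  proof (intro arg_cong[of _ _ "density lborel"] ext)
    fix x
    show "indicator {0..R} x / emeasure lborel {0..R} = ennreal (indicator {0..R} x * (1 / R))"
      using assms divide_ennreal[of 1 R] by (cases "x \<in> {0..R}") simp_all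
  qed
qed (use assms in \<open>auto simp: set_borel_measurable_def\<close>)

lemma sum_inverse_sqrt_le: "(\<Sum>t = 1..T. 1 / sqrt (real t)) \<le> 2 * sqrt (real T)"
proof (induction T)
  case (Suc T)
  let ?a = "sqrt (real T)" and ?b = "sqrt (real (Suc T))"
  \<comment> \<open>Since \<open>?b * ?b = ?a * ?a + 1\<close>, this square yields 1 /
    \<open>?b\<close> \<le> 2 (\<open>?b\<close> - \<open>?a\<close>), so the sum
    telescopes.\<close>
  have "0 \<le> (?b - ?a)\<^sup>2" by simp
  then have "2 * ?a * ?b + 1 \<le> 2 * (?b * ?b)" by (simp add: power2_eq_square algebra_simps)
  then have "2 * ?a + 1 / ?b \<le> 2 * ?b" by (simp add: field_simps del: of_nat_Suc real_sqrt_mult_self)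
  with Suc show ?case by simp
qed simp

theorem theorem2:
  "\<exists>C::real. C > 0 \<and>
     (\<forall>(R::real) (P0::real measure) (p0::real \<Rightarrow> real). R > 0 \<longrightarrow> positive_density R P0 p0 \<longrightarrow>
       (let lam = (\<lambda>t::nat. 1 / sqrt (real t)) in
         (\<forall>(T::nat) (s::nat \<Rightarrow> real) (\<alpha>::real).
            T \<ge> 1 \<longrightarrow> (\<forall>t\<in>{1..T}. s t \<in> {0..R}) \<longrightarrow> \<alpha> \<in> {0..1} \<longrightarrow>
            ereal (regret R P0 lam s \<alpha> T) \<le>
              ereal C *
                (ereal (prior_loss P0 \<alpha> (quantile R \<alpha> (empirical s T)) * sqrt (real T)) +
                 (\<Sum>t = 1..T. 1 / ereal (min_density p0 (alg_output R P0 lam s \<alpha> t) (s t) * sqrt (real t)))))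
         \<and>
         (P0 = uniform_measure lborel {0..R} \<longrightarrow>
           (\<forall>(T::nat) (s::nat \<Rightarrow> real) (\<alpha>::real).
              T \<ge> 1 \<longrightarrow> (\<forall>t\<in>{1..T}. s t \<in> {0..R}) \<longrightarrow> \<alpha> \<in> {0..1} \<longrightarrow>
              regret R P0 lam s \<alpha> T \<le> C * R * sqrt (real T)))))"
proof (intro exI[of _ 5] conjI allI impI)
  \<comment> \<open>The uniform case dictates 5 = 3 + 2: 3 R \<surd>T from the prior loss, which is
    at most R, and 2 R \<surd>T from the sum of 1 / \<surd>t.\<close>
  show "(0::real) < 5" by simp
next
  fix R :: real and P0 :: "real measure" and p0 :: "real \<Rightarrow> real"
  assume R: "R > 0" and dens: "positive_density R P0 p0"
  interpret interval_distribution P0 R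
    by (rule positive_density_interval_distribution[OF dens])
  have general: "ereal (regret R P0 sqrt_step s \<alpha> T) \<le>
      ereal 5 * (ereal (prior_loss P0 \<alpha> (quantile R \<alpha> (empirical s T)) * sqrt (real T)) +
        (\<Sum>t = 1..T. 1 / ereal (min_density p0 (alg_output R P0 sqrt_step s \<alpha> t) (s t) * sqrt (real t))))"
    if T: "T \<ge> 1" and s: "\<forall>t\<in>{1..T}. s t \<in> {0..R}" and \<alpha>: "\<alpha> \<in> {0..1}" for T s \<alpha>
  proof -
    let ?q = "alg_output R P0 sqrt_step s \<alpha>"
    define \<mu> where "\<mu> t = min_density p0 (?q t) (s t)" for t
    let ?\<psi> = "prior_loss P0 \<alpha> (quantile R \<alpha> (empirical s T)) * sqrt (real T)"
    have \<psi>: "0 \<le> ?\<psi>" using prior_loss_nonneg[OF \<alpha>] by simp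
    \<comment> \<open>Positivity of \<open>p0\<close> is known only on \<open>[0, R]\<close>; this
      inclusion makes the image under \<open>p0\<close> bounded below, so that its infimum is
      meaningful.\<close>
    have sub: "{min (?q t) (s t)..max (?q t) (s t)} \<subseteq> {0..R}" if "t \<in> {1..T}" for t
    proof -
      have "?q t \<in> {0..R}"
        by (rule alg_output_in_interval[OF interval_distribution_axioms \<alpha>]) (use that s in auto)
      moreover have "s t \<in> {0..R}" using s that by blast
      ultimately show ?thesis by auto
    qed
    have p0: "0 < p0 x" if "x \<in> {0..R}" for x
      using dens that by (auto simp: positive_density_def)
    have image_nonneg: "0 \<le> y" if "t \<in> {1..T}" "y \<in> p0 ` {min (?q t) (s t)..max (?q t) (s t)}" for t y
      using sub[OF that(1)] that(2) p0 by (blast intro: less_imp_le)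
    have nonneg: "0 \<le> \<mu> t" if "t \<in> {1..T}" for t
      unfolding \<mu>_def min_density_def
      by (intro cInf_greatest image_nonneg[OF that]) auto
    have lower: "\<mu> t \<le> p0 x" if "t \<in> {1..T}" "x \<in> {min (?q t) (s t)..max (?q t) (s t)}" for t x
      unfolding \<mu>_def min_density_def
    proof (rule cInf_lower)
      show "bdd_below (p0 ` {min (?q t) (s t)..max (?q t) (s t)})"
        by (intro bdd_belowI[of _ 0] image_nonneg[OF that(1)])
    qed (use that in auto)
    show ?thesis
    proof (cases "\<forall>t\<in>{1..T}. \<mu> t > 0")
      case True
      have "regret R P0 sqrt_step s \<alpha> T \<le> 3 * ?\<psi> + (\<Sum>t = 1..T. 1 / (\<mu> t * sqrt (real t)))"
        by (rule regret_le_density[OF dens \<alpha> T]) (use s True lower in auto)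
      moreover have "0 \<le> (\<Sum>t = 1..T. 1 / (\<mu> t * sqrt (real t)))"
        using nonneg by (intro sum_nonneg) auto
      ultimately have "regret R P0 sqrt_step s \<alpha> T \<le> 5 * (?\<psi> + (\<Sum>t = 1..T. 1 / (\<mu> t * sqrt (real t))))"
        using \<psi> unfolding distrib_left by linarith
      moreover have "(\<Sum>t = 1..T. 1 / ereal (\<mu> t * sqrt (real t))) = ereal (\<Sum>t = 1..T. 1 / (\<mu> t * sqrt (real t)))"
      proof (subst sum_ereal[symmetric], rule sum.cong)
        fix t assume "t \<in> {1..T}"
        then have "\<mu> t * sqrt (real t) \<noteq> 0" using True by force
        then show "1 / ereal (\<mu> t * sqrt (real t)) = ereal (1 / (\<mu> t * sqrt (real t)))"
          by (simp add: one_ereal_def)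
      qed simp
      ultimately show ?thesis unfolding \<mu>_def[symmetric] by simp
    next
      \<comment> \<open>A positive density can have infimum 0. The corresponding term is then 1 / 0
        = \<infinity> in the extended reals, and the bound is trivial.\<close>
      case False
      then obtain t where t: "t \<in> {1..T}" "\<mu> t = 0" using nonneg by force
      then have "1 / ereal (\<mu> t * sqrt (real t)) = \<infinity>"
        by (simp add: one_ereal_def divide_ereal_def)
      then have "(\<Sum>t = 1..T. 1 / ereal (\<mu> t * sqrt (real t))) = \<infinity>"
        using t by (subst sum_Pinfty) blast
      then show ?thesis unfolding \<mu>_def[symmetric] by simp
    qed
  qed
  have uniform: "regret R P0 sqrt_step s \<alpha> T \<le> 5 * R * sqrt (real T)"
    if P0: "P0 = uniform_measure lborel {0..R}" and T: "T \<ge> 1"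
      and s: "\<forall>t\<in>{1..T}. s t \<in> {0..R}" and \<alpha>: "\<alpha> \<in> {0..1}" for T s \<alpha>
  proof -
    let ?u = "quantile R \<alpha> (empirical s T)"
    have u: "?u \<in> {0..R}"
      by (rule interval_distribution.quantile_in_interval[OF interval_distribution_empirical \<alpha>])
        (use T s in auto)
    have "regret R P0 sqrt_step s \<alpha> T
        \<le> 3 * (prior_loss P0 \<alpha> ?u * sqrt (real T)) + (\<Sum>t = 1..T. 1 / (1 / R * sqrt (real t)))"
      \<comment> \<open>The given \<open>p0\<close> may differ from 1 / R on a null set, so the
        constant version of the density is used.\<close>
      by (rule regret_le_density[OF _ \<alpha> T])
        (use s R positive_density_uniform[OF R] in \<open>auto simp: P0\<close>)
    also have "(\<Sum>t = 1..T. 1 / (1 / R * sqrt (real t))) = R * (\<Sum>t = 1..T. 1 / sqrt (real t))"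
      by (simp add: sum_distrib_left)
    also have "\<dots> \<le> R * (2 * sqrt (real T))"
      using R sum_inverse_sqrt_le by (intro mult_left_mono) auto
    also have "prior_loss P0 \<alpha> ?u * sqrt (real T) \<le> R * sqrt (real T)"
      by (intro mult_right_mono prior_loss_le \<alpha> u) auto
    finally show ?thesis by simp
  qed
  show "let lam = sqrt_step in
      (\<forall>T s \<alpha>. T \<ge> 1 \<longrightarrow> (\<forall>t\<in>{1..T}. s t \<in> {0..R}) \<longrightarrow> \<alpha> \<in> {0..1} \<longrightarrow>
        ereal (regret R P0 lam s \<alpha> T) \<le>
          ereal 5 *
            (ereal (prior_loss P0 \<alpha> (quantile R \<alpha> (empirical s T)) * sqrt (real T)) +
             (\<Sum>t = 1..T. 1 / ereal (min_density p0 (alg_output R P0 lam s \<alpha> t) (s t) * sqrt (real t))))) \<and>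
      (P0 = uniform_measure lborel {0..R} \<longrightarrow>
        (\<forall>T s \<alpha>. T \<ge> 1 \<longrightarrow> (\<forall>t\<in>{1..T}. s t \<in> {0..R}) \<longrightarrow> \<alpha> \<in> {0..1} \<longrightarrow>
          regret R P0 lam s \<alpha> T \<le> 5 * R * sqrt (real T)))"
    unfolding Let_def using general uniform by blast
qed

end
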